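(* Let $1\leq p<\infty$. Suppose that $X$ is a reflexive Banach space and $K$ is a weakly $p$-limited subset of $X^{*}$. If $K$ is not relatively norm compact, then there exists a seminormalized biorthogonal sequence $(x_{n},x_{n}^{*})_{n}$ in $X\times(K-K)$ such that $(x_{n}^{*})_{n}$ is a basic sequence and $(x_{n})_{n}$ has no weakly $p$-Cauchy subsequence.
   Context: Banach spaces are real or complex. $K-K=\{f-g:f,g\in K\}$. A sequence $(x_n)_n$ in $X$ is weakly $p$-summable, written $(x_n)_n\in l_p^w(X)$, if $\sup\{(\sum_{n=1}^{\infty}|\langle x^*,x_n\rangle|^p)^{1/p}:x^*\in B_{X^*}\}<\infty$, where $B_{X^*}$ is the closed unit ball of $X^*$. A bounded subset $K$ of $X^*$ is weakly $p$-limited if $\lim_{n\to\infty}\sup_{x^*\in K}|\langle x^*,x_n\rangle|=0$ for every $(x_n)_n\in l_p^w(X)$. A sequence $(x_n)_n$ is weakly $p$-Cauchy if for each pair of strictly increasing sequences $(k_n)_n$, $(j_n)_n$ of positive integers, $(x_{k_n}-x_{j_n})_n$ is weakly $p$-summable. Biorthogonal means $\langle x_n^*,x_m\rangle=\delta_{nm}$; seminormalized means that both $(\|x_n\|)_n$ and $(\|x_n^*\|)_n$ are bounded and bounded away from $0$. A basic sequence is a Schauder basis of its closed linear span. *)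

theory Defs
  imports "HOL-Analysis.Analysis"
begin

text \<open>
  Scalar fields: up to isometric isomorphism the members of this class are exactly the real and
  the complex numbers, so a statement over an arbitrary member covers both cases.
\<close>

class real_or_complex = real_normed_field +
  assumes real_or_complex_cases:
    "(\<forall>z. \<exists>a. z = a *\<^sub>R 1) \<or>
     (\<exists>i. i * i = - 1 \<and> (\<forall>z. \<exists>a b. z = a *\<^sub>R 1 + b *\<^sub>R i) \<and>
          (\<forall>a b. norm (a *\<^sub>R 1 + b *\<^sub>R i) = sqrt (a\<^sup>2 + b\<^sup>2)))"

instance real :: real_or_complex
  by standard auto

instance complex :: real_or_complex
proof
  have "\<i> * \<i> = - 1" by simp
  moreover have "\<exists>a b. z = a *\<^sub>R 1 + b *\<^sub>R \<i>" for z
    by (intro exI[of _ "Re z"] exI[of _ "Im z"]) (simp add: complex_eq_iff)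
  moreover have "norm (a *\<^sub>R 1 + b *\<^sub>R \<i>) = sqrt (a\<^sup>2 + b\<^sup>2)" for a b
    by (simp add: cmod_def)
  ultimately show "(\<forall>z::complex. \<exists>a. z = a *\<^sub>R 1) \<or>
     (\<exists>i::complex. i * i = - 1 \<and> (\<forall>z. \<exists>a b. z = a *\<^sub>R 1 + b *\<^sub>R i) \<and>
          (\<forall>a b. norm (a *\<^sub>R 1 + b *\<^sub>R i) = sqrt (a\<^sup>2 + b\<^sup>2)))"
    by blast
qed

text \<open>
  A Banach space over such a field: completeness and the norm come from class \<^class>\<open>banach\<close>;
  \<open>scl\<close> is the scalar multiplication, which extends the real one (over the reals it is
  \<^const>\<open>scaleR\<close>).
\<close>

locale banach_space_over = vector_space scl
  for scl :: "'k::real_or_complex \<Rightarrow> 'a::banach \<Rightarrow> 'a" +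
  assumes scl_of_real: "scl (of_real r) x = r *\<^sub>R x"
    and norm_scl: "norm (scl c x) = norm c * norm x"

lemma banach_space_over_real: "banach_space_over (scaleR :: real \<Rightarrow> 'a::banach \<Rightarrow> 'a)"
  by unfold_locales (auto simp: algebra_simps)

lemma banach_space_over_real_unique:
  assumes "banach_space_over (scl :: real \<Rightarrow> 'a::banach \<Rightarrow> 'a)"
  shows "scl = scaleR"
  using banach_space_over.scl_of_real[OF assms] by (auto simp: fun_eq_iff)

lemma banach_space_over_complex: "banach_space_over ((*) :: complex \<Rightarrow> complex \<Rightarrow> complex)"
  by unfold_locales (auto simp: algebra_simps norm_mult scaleR_conv_of_real)

text \<open>
  The dual space is the norm-closed set of those bounded real-linear maps into the field that are
  linear over the field. The norm of \<^typ>\<open>'a \<Rightarrow>\<^sub>L 'k\<close> restricts to the dual norm, and closures of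
  subsets of the dual may be taken in \<^typ>\<open>'a \<Rightarrow>\<^sub>L 'k\<close>.
\<close>

definition dual :: "('k::real_or_complex \<Rightarrow> 'a::banach \<Rightarrow> 'a) \<Rightarrow> ('a \<Rightarrow>\<^sub>L 'k) set" where
  "dual scl = {f. \<forall>c x. blinfun_apply f (scl c x) = c * blinfun_apply f x}"

definition dual_scale :: "'k::real_or_complex \<Rightarrow> ('a::banach \<Rightarrow>\<^sub>L 'k) \<Rightarrow> ('a \<Rightarrow>\<^sub>L 'k)" where
  "dual_scale c f = Blinfun (\<lambda>x. c * blinfun_apply f x)"

lemma dual_scale_apply [simp]: "blinfun_apply (dual_scale c f) x = c * blinfun_apply f x"
  unfolding dual_scale_def
  by (subst bounded_linear_Blinfun_apply) (auto intro!: bounded_linear_intros)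

lemma vector_space_dual_scale:
  "vector_space (dual_scale :: 'k::real_or_complex \<Rightarrow> ('a::banach \<Rightarrow>\<^sub>L 'k) \<Rightarrow> ('a \<Rightarrow>\<^sub>L 'k))"
  by unfold_locales (auto intro!: blinfun_eqI simp: blinfun.add_left algebra_simps)

lemma closed_dual: "closed (dual scl)"
proof -
  have "dual scl = (\<Inter>c. \<Inter>x. {f. blinfun_apply f (scl c x) = c * blinfun_apply f x})"
    by (auto simp: dual_def)
  moreover have "closed {f. blinfun_apply f (scl c x) = c * blinfun_apply f x}" for c x
    by (intro closed_Collect_eq continuous_intros)
  ultimately show ?thesis by (metis (no_types, lifting) closed_INT)
qed

text \<open>
  Elements of the bidual are functions on the dual, hence \<^const>\<open>extensional\<close>, and reflexivity is
  surjectivity of the canonical embedding.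
\<close>

definition bidual ::
  "('k::real_or_complex \<Rightarrow> 'a::banach \<Rightarrow> 'a) \<Rightarrow> (('a \<Rightarrow>\<^sub>L 'k) \<Rightarrow> 'k) set" where
  "bidual scl = {\<phi> \<in> extensional (dual scl).
     (\<forall>f\<in>dual scl. \<forall>g\<in>dual scl. \<phi> (f + g) = \<phi> f + \<phi> g) \<and>
     (\<forall>c. \<forall>f\<in>dual scl. \<phi> (dual_scale c f) = c * \<phi> f) \<and>
     (\<exists>C. \<forall>f\<in>dual scl. norm (\<phi> f) \<le> C * norm f)}"

definition canonical_embedding ::
  "('k::real_or_complex \<Rightarrow> 'a::banach \<Rightarrow> 'a) \<Rightarrow> 'a \<Rightarrow> ('a \<Rightarrow>\<^sub>L 'k) \<Rightarrow> 'k" where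
  "canonical_embedding scl x = (\<lambda>f\<in>dual scl. blinfun_apply f x)"

definition reflexive_space :: "('k::real_or_complex \<Rightarrow> 'a::banach \<Rightarrow> 'a) \<Rightarrow> bool" where
  "reflexive_space scl \<longleftrightarrow> canonical_embedding scl ` UNIV = bidual scl"

definition weakly_p_summable ::
  "('k::real_or_complex \<Rightarrow> 'a::banach \<Rightarrow> 'a) \<Rightarrow> real \<Rightarrow> (nat \<Rightarrow> 'a) \<Rightarrow> bool" where
  "weakly_p_summable scl p x \<longleftrightarrow>
     (\<forall>f \<in> dual scl \<inter> cball 0 1. summable (\<lambda>n. norm (blinfun_apply f (x n)) powr p)) \<and>
     bdd_above ((\<lambda>f. (\<Sum>n. norm (blinfun_apply f (x n)) powr p) powr (1 / p))
                  ` (dual scl \<inter> cball 0 1))"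

text \<open>The supremum is taken in \<^typ>\<open>ennreal\<close>, so that it is \<open>0\<close> for empty \<open>K\<close>.\<close>

definition weakly_p_limited ::
  "('k::real_or_complex \<Rightarrow> 'a::banach \<Rightarrow> 'a) \<Rightarrow> real \<Rightarrow> ('a \<Rightarrow>\<^sub>L 'k) set \<Rightarrow> bool" where
  "weakly_p_limited scl p K \<longleftrightarrow> K \<subseteq> dual scl \<and> bounded K \<and>
     (\<forall>x. weakly_p_summable scl p x \<longrightarrow>
        (\<lambda>n. SUP f\<in>K. ennreal (norm (blinfun_apply f (x n)))) \<longlonglongrightarrow> 0)"

definition weakly_p_Cauchy ::
  "('k::real_or_complex \<Rightarrow> 'a::banach \<Rightarrow> 'a) \<Rightarrow> real \<Rightarrow> (nat \<Rightarrow> 'a) \<Rightarrow> bool" where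
  "weakly_p_Cauchy scl p x \<longleftrightarrow>
     (\<forall>k j. strict_mono k \<longrightarrow> strict_mono j \<longrightarrow> weakly_p_summable scl p (\<lambda>n. x (k n) - x (j n)))"

definition biorthogonal :: "(nat \<Rightarrow> 'a::banach) \<Rightarrow> (nat \<Rightarrow> 'a \<Rightarrow>\<^sub>L 'k::real_or_complex) \<Rightarrow> bool" where
  "biorthogonal x f \<longleftrightarrow> (\<forall>n m. blinfun_apply (f n) (x m) = (if n = m then 1 else 0))"

definition bounded_and_away_from_zero :: "(nat \<Rightarrow> 'b::real_normed_vector) \<Rightarrow> bool" where
  "bounded_and_away_from_zero u \<longleftrightarrow> (\<exists>a>0. \<exists>b. \<forall>n. a \<le> norm (u n) \<and> norm (u n) \<le> b)"

definition seminormalized ::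
  "(nat \<Rightarrow> 'a::banach) \<Rightarrow> (nat \<Rightarrow> 'a \<Rightarrow>\<^sub>L 'k::real_or_complex) \<Rightarrow> bool" where
  "seminormalized x f \<longleftrightarrow> bounded_and_away_from_zero x \<and> bounded_and_away_from_zero f"

definition schauder_basis ::
  "('k::real_or_complex \<Rightarrow> 'b::real_normed_vector \<Rightarrow> 'b) \<Rightarrow> 'b set \<Rightarrow> (nat \<Rightarrow> 'b) \<Rightarrow> bool" where
  "schauder_basis scl E e \<longleftrightarrow>
     range e \<subseteq> E \<and> (\<forall>v\<in>E. \<exists>!a. (\<lambda>n. scl (a n) (e n)) sums v)"

definition basic_sequence ::
  "('k::real_or_complex \<Rightarrow> 'b::real_normed_vector \<Rightarrow> 'b) \<Rightarrow> (nat \<Rightarrow> 'b) \<Rightarrow> bool" where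
  "basic_sequence scl e \<longleftrightarrow> schauder_basis scl (closure (module.span scl (range e))) e"

end

theory Submission
  imports Defs
begin

text \<open>
  Write \<open>D\<close> for the set of differences \<open>K - K\<close>. Everything rests on producing a biorthogonal
  sequence \<open>x\<^sub>n, f\<^sub>n\<close> with bounded \<open>x\<^sub>n\<close>, with \<open>f\<^sub>n\<close> in \<open>D\<close>, and with the partial sum operators
  of \<open>f\<^sub>n\<close> uniformly bounded. Such a sequence has no weakly \<open>p\<close>-Cauchy subsequence: if
  \<open>x (r n) - x (r (n + 1))\<close> were weakly \<open>p\<close>-summable, then the members of \<open>K\<close>, and hence those of \<open>D\<close>, would tend to
  \<open>0\<close> uniformly along it, whereas \<open>f (r n)\<close> takes the value \<open>1\<close> there.

  Since \<open>K\<close> is not totally bounded, it contains an \<open>\<epsilon>\<close>-separated sequence, and by the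
  pigeonhole principle for bounded scalars two of its members nearly agree on any given finite
  set of vectors. So \<open>D\<close> contains functionals of norm at least \<open>\<epsilon>\<close> that are as small as desired on a given
  finite set (\<open>small_on_finite_set_not_small_in_norm\<close>).

  The dual requirement is that the witness \<open>x\<close> of the norm of \<open>f\<close> be annihilated by given
  functionals \<open>g\<close> in a finite set \<open>F\<close> without losing control of its norm. To achieve it, repeat the
  choice, each new \<open>f\<^sub>k\<close> being small on all earlier witnesses \<open>y\<^sub>l\<close>; by the pigeonhole principle
  the values of \<open>F\<close> at some \<open>y\<^sub>k\<close> and \<open>y\<^sub>l\<close> with \<open>l < k\<close> nearly agree, so that
  \<open>y\<^sub>k - y\<^sub>l\<close> is nearly annihilated by \<open>F\<close>, while \<open>f\<^sub>k\<close> is still large on it. A small correction makes the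
  annihilation exact (\<open>almost_annihilating_pair\<close>).

  With such pairs \<open>(f, x)\<close> a finite biorthogonal system is enlarged by replacing each old \<open>v\<^sub>m\<close> by
  \<open>v\<^sub>m - f(v\<^sub>m) x\<close>. As \<open>f(v\<^sub>m)\<close> is at most a power of \<open>1/2\<close>, the vectors converge and the limits
  stay biorthogonal and bounded. The functionals are also chosen small on finite sets norming the
  spans of their predecessors, as in Mazur's construction of basic sequences, and this bounds the
  partial sum operators (\<open>biorthogonal_sequence_with_bounded_truncations\<close>).
\<close>

section \<open>Compactness of the scalars\<close>

lemma bounded_sequence_transfer:
  fixes \<phi> :: "'h::{real_normed_vector, heine_borel} \<Rightarrow> 'b::real_normed_vector" and s :: "nat \<Rightarrow> 'b"
  assumes \<phi>: "bounded_linear \<phi>" and onto: "\<And>z. \<exists>w. \<phi> w = z \<and> norm w = norm z"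
    and bd: "bounded (range s)"
  shows "\<exists>l r. strict_mono r \<and> (s \<circ> r) \<longlonglongrightarrow> l"
proof -
  have "\<exists>t. \<forall>n. \<phi> (t n) = s n \<and> norm (t n) = norm (s n)"
    by (intro choice allI onto)
  then obtain t where t: "\<And>n. \<phi> (t n) = s n" "\<And>n. norm (t n) = norm (s n)"
    by blast
  have "bounded (range t)"
    using bd t(2) by (auto simp: bounded_iff)
  then obtain l r where r: "strict_mono r" and lim: "(t \<circ> r) \<longlonglongrightarrow> l"
    using bounded_imp_convergent_subsequence by blast
  have "(\<lambda>n. \<phi> ((t \<circ> r) n)) \<longlonglongrightarrow> \<phi> l"
    using bounded_linear.tendsto[OF \<phi> lim] .
  then have "(s \<circ> r) \<longlonglongrightarrow> \<phi> l"
    by (simp add: t(1) o_def)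
  with r show ?thesis by blast
qed

text \<open>
  The class only says that the scalars are linearly isometric to the reals or to the complex
  numbers, so the Bolzano-Weierstrass property has to be transferred. Its consequence, completeness of the field,
  is what makes the dual space complete.
\<close>
instance real_or_complex \<subseteq> heine_borel
proof
  fix s :: "nat \<Rightarrow> 'a"
  assume bd: "bounded (range s)"
  consider (real) "\<forall>z::'a. \<exists>a. z = a *\<^sub>R 1"
    | (complex) i :: 'a where "\<forall>z. \<exists>a b. z = a *\<^sub>R 1 + b *\<^sub>R i"
        "\<forall>a b. norm (a *\<^sub>R 1 + b *\<^sub>R i) = sqrt (a\<^sup>2 + b\<^sup>2)"
    using real_or_complex_cases by blast
  then show "\<exists>l r. strict_mono r \<and> (s \<circ> r) \<longlonglongrightarrow> l"
  proof cases
    case real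
    show ?thesis
    proof (rule bounded_sequence_transfer[OF _ _ bd])
      show "bounded_linear (\<lambda>a. a *\<^sub>R (1::'a))"
        by (rule bounded_linear_scaleR_left)
      show "\<exists>a. a *\<^sub>R 1 = z \<and> norm a = norm z" for z :: 'a
      proof -
        obtain a where "z = a *\<^sub>R 1" using real by blast
        then show ?thesis by (intro exI[of _ a]) simp
      qed
    qed
  next
    case complex
    show ?thesis
    proof (rule bounded_sequence_transfer[OF _ _ bd])
      show "bounded_linear (\<lambda>w. Re w *\<^sub>R 1 + Im w *\<^sub>R i)"
        by (intro bounded_linear_intros bounded_linear_Re bounded_linear_Im
            bounded_linear_add bounded_linear_compose[OF bounded_linear_scaleR_left])
      show "\<exists>w. Re w *\<^sub>R 1 + Im w *\<^sub>R i = z \<and> norm w = norm z" for z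
      proof -
        obtain a b where "z = a *\<^sub>R 1 + b *\<^sub>R i" using complex(1) by blast
        then show ?thesis using complex(2) by (intro exI[of _ "Complex a b"]) (simp add: cmod_def)
      qed
    qed
  qed
qed

instance real_or_complex \<subseteq> banach ..

section \<open>Pigeonhole principle and separated sequences\<close>

text \<open>
  Successive extraction over the finite index set gives a subsequence that converges in every
  coordinate; two consecutive terms of it far enough out form the pair.
\<close>
lemma pigeonhole_scalars:
  fixes u :: "nat \<Rightarrow> 'i \<Rightarrow> 'k::{real_normed_vector, heine_borel}"
  assumes "finite I" and "\<And>i. i \<in> I \<Longrightarrow> bounded (range (\<lambda>n. u n i))" and "\<delta> > 0"
  shows "\<exists>l k. l < k \<and> (\<forall>i\<in>I. norm (u k i - u l i) < \<delta>)"
proof -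
  have "\<exists>r::nat \<Rightarrow> nat. strict_mono r \<and> (\<forall>i\<in>I. convergent (\<lambda>n. u (r n) i))"
    using assms(1,2)
  proof (induction I)
    case empty
    show ?case by (auto intro: exI[of _ id] simp: strict_mono_def)
  next
    case (insert j I)
    then obtain r :: "nat \<Rightarrow> nat" where r: "strict_mono r" "\<And>i. i \<in> I \<Longrightarrow> convergent (\<lambda>n. u (r n) i)"
      by auto
    have "bounded (range (\<lambda>n. u (r n) j))"
      by (rule bounded_subset[OF insert.prems[of j]]) auto
    then obtain l t where t: "strict_mono t" and lim: "((\<lambda>n. u (r n) j) \<circ> t) \<longlonglongrightarrow> l"
      using bounded_imp_convergent_subsequence by blast
    have "convergent (\<lambda>n. u ((r \<circ> t) n) i)" if "i \<in> insert j I" for i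
    proof (cases "i = j")
      case True
      with lim show ?thesis by (auto simp: convergent_def o_def)
    next
      case False
      with that have "i \<in> I" by simp
      from convergent_subseq_convergent[OF r(2)[OF this] t] show ?thesis by (simp add: o_def)
    qed
    with strict_mono_o[OF r(1) t] show ?case by blast
  qed
  then obtain r :: "nat \<Rightarrow> nat" where r: "strict_mono r" "\<And>i. i \<in> I \<Longrightarrow> convergent (\<lambda>n. u (r n) i)"
    by blast
  have "\<forall>\<^sub>F n in sequentially. norm (u (r (Suc n)) i - u (r n) i) < \<delta>" if "i \<in> I" for i
  proof -
    have "Cauchy (\<lambda>n. u (r n) i)" using r(2)[OF that] by (rule convergent_Cauchy)
    then obtain N where "\<And>m n. m \<ge> N \<Longrightarrow> n \<ge> N \<Longrightarrow> norm (u (r m) i - u (r n) i) < \<delta>"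
      using \<open>\<delta> > 0\<close> by (meson Cauchy_iff)
    then show ?thesis by (auto simp: eventually_sequentially intro!: exI[of _ N])
  qed
  then have "\<forall>\<^sub>F n in sequentially. \<forall>i\<in>I. norm (u (r (Suc n)) i - u (r n) i) < \<delta>"
    using \<open>finite I\<close> by (simp add: eventually_ball_finite)
  then obtain n where "\<forall>i\<in>I. norm (u (r (Suc n)) i - u (r n) i) < \<delta>"
    by (auto simp: eventually_sequentially)
  moreover have "r n < r (Suc n)" using r(1) by (simp add: strict_mono_def)
  ultimately show ?thesis by blast
qed

lemma finite_net_or_separated_sequence:
  fixes S :: "'b::metric_space set"
  shows "(\<exists>T. finite T \<and> T \<subseteq> S \<and> (\<forall>x\<in>S. \<exists>t\<in>T. dist x t < e)) \<or>
    (\<exists>s::nat \<Rightarrow> 'b. range s \<subseteq> S \<and> (\<forall>m n. m < n \<longrightarrow> e \<le> dist (s n) (s m)))"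
proof (rule iffD2[OF disj_imp], rule impI)
  assume nonet: "\<not> (\<exists>T. finite T \<and> T \<subseteq> S \<and> (\<forall>x\<in>S. \<exists>t\<in>T. dist x t < e))"
  let ?P = "\<lambda>s (n::nat) x. x \<in> S \<and> (\<forall>m<n. e \<le> dist x (s m))"
  have "\<exists>s. \<forall>n. ?P s n (s n)"
  proof (rule dependent_wellorder_choice)
    fix n s
    assume s: "\<And>j. j < n \<Longrightarrow> ?P s j (s j)"
    then have "finite (s ` {..<n}) \<and> s ` {..<n} \<subseteq> S" by auto
    with nonet have "\<not> (\<forall>x\<in>S. \<exists>t\<in>s ` {..<n}. dist x t < e)" by blast
    then show "\<exists>x. ?P s n x" by (force simp: not_less)
  qed simp
  then show "\<exists>s::nat \<Rightarrow> 'b. range s \<subseteq> S \<and> (\<forall>m n. m < n \<longrightarrow> e \<le> dist (s n) (s m))"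
    by blast
qed

section \<open>Functionals that are large in norm but small on finite sets\<close>

lemma almost_norming_vector:
  fixes f :: "'a::real_normed_vector \<Rightarrow>\<^sub>L 'b::real_normed_vector"
  assumes "c < norm f"
  shows "\<exists>y. norm y \<le> 1 \<and> c < norm (f y)"
proof (rule ccontr)
  assume no: "\<not> ?thesis"
  then have le: "norm y \<le> 1 \<Longrightarrow> norm (f y) \<le> c" for y by force
  have "0 \<le> c" using le[of 0] by (simp add: blinfun.zero_right)
  have "norm f \<le> c"
  proof (rule norm_blinfun_bound[OF \<open>0 \<le> c\<close>])
    fix x
    show "norm (f x) \<le> c * norm x"
    proof (cases "x = 0")
      case False
      have "norm (f (x /\<^sub>R norm x)) \<le> c" using False by (intro le) simp
      with False show ?thesis by (simp add: blinfun.scaleR_right field_simps)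
    qed (simp add: blinfun.zero_right)
  qed
  with assms show False by simp
qed

text \<open>
  Completeness of the dual turns failure of relative compactness into failure of total
  boundedness, so \<open>K\<close> has an \<open>\<epsilon>\<close>-separated sequence. Its values on a finite set are bounded, hence two
  members nearly agree there, and their difference is the required functional.
\<close>
lemma small_on_finite_set_not_small_in_norm:
  fixes K :: "('a::banach \<Rightarrow>\<^sub>L 'k::real_or_complex) set"
  assumes bd: "bounded K" and nc: "\<not> compact (closure K)"
  shows "\<exists>\<epsilon>>0. \<forall>Y \<delta>. finite Y \<longrightarrow> \<delta> > 0 \<longrightarrow>
    (\<exists>f\<in>{g - h | g h. g \<in> K \<and> h \<in> K}. \<epsilon> \<le> norm f \<and> (\<forall>y\<in>Y. norm (blinfun_apply f y) < \<delta>))"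
proof -
  have "\<exists>e>0. \<not> (\<exists>T. finite T \<and> T \<subseteq> K \<and> (\<forall>x\<in>K. \<exists>t\<in>T. dist x t < e))"
  proof (rule ccontr)
    assume "\<not> ?thesis"
    then have tb: "\<exists>T. finite T \<and> T \<subseteq> K \<and> (\<forall>x\<in>K. \<exists>t\<in>T. dist x t < e)" if "e > 0" for e
      using that by blast
    have "\<exists>T. finite T \<and> closure K \<subseteq> (\<Union>t\<in>T. ball t e)" if "e > 0" for e
    proof -
      obtain T where T: "finite T" "\<forall>x\<in>K. \<exists>t\<in>T. dist x t < e / 2"
        using tb[of "e / 2"] \<open>e > 0\<close> by auto
      have "K \<subseteq> (\<Union>t\<in>T. cball t (e / 2))"
        using T(2) by (force simp: dist_commute less_imp_le)
      moreover have "closed (\<Union>t\<in>T. cball t (e / 2))"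
        using T(1) by (intro closed_UN) auto
      ultimately have "closure K \<subseteq> (\<Union>t\<in>T. cball t (e / 2))"
        by (rule closure_minimal)
      also have "\<dots> \<subseteq> (\<Union>t\<in>T. ball t e)" using \<open>e > 0\<close> by force
      finally show ?thesis using T(1) by blast
    qed
    moreover have "complete (closure K)" by (simp add: complete_eq_closed)
    ultimately show False using nc by (simp add: compact_eq_totally_bounded)
  qed
  then obtain e where "e > 0"
    and nonet: "\<not> (\<exists>T. finite T \<and> T \<subseteq> K \<and> (\<forall>x\<in>K. \<exists>t\<in>T. dist x t < e))" by blast
  with finite_net_or_separated_sequence[of K e] obtain s :: "nat \<Rightarrow> 'a \<Rightarrow>\<^sub>L 'k"
    where sK: "range s \<subseteq> K" and sep: "\<And>m n. m < n \<Longrightarrow> e \<le> dist (s n) (s m)" by blast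
  obtain B where B: "\<And>g. g \<in> K \<Longrightarrow> norm g \<le> B" using bd by (auto simp: bounded_iff)
  have "\<exists>f\<in>{g - h | g h. g \<in> K \<and> h \<in> K}. e \<le> norm f \<and> (\<forall>y\<in>Y. norm (blinfun_apply f y) < \<delta>)"
    if Y: "finite Y" and \<delta>: "\<delta> > 0" for Y and \<delta> :: real
  proof -
    have "bounded (range (\<lambda>n. s n y))" for y
    proof -
      have "norm (s n y) \<le> B * norm y" for n
      proof -
        have "norm (s n) \<le> B" using B sK by blast
        then show ?thesis
          using norm_blinfun[of "s n" y] mult_right_mono[of "norm (s n)" B "norm y"] by simp
      qed
      then show ?thesis by (auto simp: bounded_iff)
    qed
    then obtain l k where "l < k" and lk: "\<forall>y\<in>Y. norm (s k y - s l y) < \<delta>"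
      using pigeonhole_scalars[where u = "\<lambda>n y. s n y", OF Y _ \<delta>] by blast
    have "e \<le> norm (s k - s l)" using sep[OF \<open>l < k\<close>] by (simp add: dist_norm)
    moreover have "\<forall>y\<in>Y. norm ((s k - s l) y) < \<delta>" using lk by (simp add: blinfun.diff_left)
    moreover have "s k \<in> K" "s l \<in> K" using sK by auto
    ultimately show ?thesis by blast
  qed
  with \<open>e > 0\<close> show ?thesis by blast
qed

section \<open>Witnesses annihilated by finitely many functionals\<close>

text \<open>
  The value map of a finite set of functionals is open onto its range. The induction adds \<open>h\<close> to \<open>F\<close>:
  either \<open>h\<close> is nonzero somewhere on the common kernel of \<open>F\<close>, and a multiple of such a vector
  corrects the value of \<open>h\<close> without disturbing \<open>F\<close>, or \<open>h\<close> vanishes on that kernel, and then the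
  values of \<open>F\<close> already determine that of \<open>h\<close>.
\<close>
lemma controlled_lift:
  fixes scl :: "'k::real_or_complex \<Rightarrow> 'a::banach \<Rightarrow> 'a"
  assumes scl: "banach_space_over scl" and "finite F" "F \<subseteq> dual scl"
  shows "\<exists>C\<ge>0. \<forall>x. \<exists>z. (\<forall>g\<in>F. blinfun_apply g z = blinfun_apply g x) \<and>
    norm z \<le> C * (\<Sum>g\<in>F. norm (blinfun_apply g x))"
  using assms(2,3)
proof (induction F)
  case empty
  show ?case by (intro exI[of _ 0] conjI allI exI[of _ 0]) auto
next
  case (insert h F)
  then obtain C where "C \<ge> 0" and
    C: "\<And>x. \<exists>z. (\<forall>g\<in>F. blinfun_apply g z = blinfun_apply g x) \<and>
    norm z \<le> C * (\<Sum>g\<in>F. norm (blinfun_apply g x))"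
    by auto
  have lin: "blinfun_apply g (scl c x) = c * blinfun_apply g x" if "g \<in> insert h F" for g c x
    using insert.prems that by (auto simp: dual_def)
  let ?S = "\<lambda>x. \<Sum>g\<in>F. norm (blinfun_apply g x)"
  have sum_insert: "(\<Sum>g\<in>insert h F. norm (blinfun_apply g x)) = norm (blinfun_apply h x) + ?S x" for x
    using insert.hyps by simp
  have S_nonneg: "0 \<le> ?S x" for x by (simp add: sum_nonneg)
  show ?case
  proof (cases "\<exists>w. (\<forall>g\<in>F. blinfun_apply g w = 0) \<and> blinfun_apply h w \<noteq> 0")
    case True
    then obtain w0 where w0: "\<And>g. g \<in> F \<Longrightarrow> blinfun_apply g w0 = 0" "blinfun_apply h w0 \<noteq> 0"
      by blast
    define w where "w = scl (inverse (blinfun_apply h w0)) w0"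
    have w: "\<And>g. g \<in> F \<Longrightarrow> blinfun_apply g w = 0" "blinfun_apply h w = 1"
      using w0 by (simp_all add: w_def lin)
    define C' where "C' = C + (1 + norm h * C) * norm w"
    have "C' \<ge> 0" using \<open>C \<ge> 0\<close> by (simp add: C'_def)
    moreover have "\<exists>z. (\<forall>g\<in>insert h F. blinfun_apply g z = blinfun_apply g x) \<and>
      norm z \<le> C' * (\<Sum>g\<in>insert h F. norm (blinfun_apply g x))" for x
    proof -
      obtain z where z: "\<And>g. g \<in> F \<Longrightarrow> blinfun_apply g z = blinfun_apply g x"
        "norm z \<le> C * ?S x"
        using C by blast
      define c where "c = blinfun_apply h x - blinfun_apply h z"
      have "norm c \<le> norm (blinfun_apply h x) + norm h * norm z"
        unfolding c_def using norm_triangle_ineq4 norm_blinfun[of h z]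
        by (meson add_left_mono order_trans)
      also have "\<dots> \<le> norm (blinfun_apply h x) + norm h * (C * ?S x)"
        using z(2) by (simp add: mult_left_mono)
      finally have c: "norm c \<le> norm (blinfun_apply h x) + norm h * C * ?S x"
        by (simp add: mult_ac)
      have "norm (z + scl c w) \<le> norm z + norm c * norm w"
        using norm_triangle_ineq[of z "scl c w"] by (simp add: banach_space_over.norm_scl[OF scl])
      also have "\<dots> \<le> C * ?S x + (norm (blinfun_apply h x) + norm h * C * ?S x) * norm w"
        using z(2) c by (intro add_mono mult_right_mono) auto
      also have "\<dots> \<le> C' * (norm (blinfun_apply h x) + ?S x)"
        using \<open>C \<ge> 0\<close> S_nonneg[of x]
        by (simp add: C'_def algebra_simps)
      finally show ?thesis
        using z(1) w by (intro exI[of _ "z + scl c w"]) (auto simp: sum_insert blinfun.add_right lin c_def)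
    qed
    ultimately show ?thesis by blast
  next
    case False
    have "\<exists>z. (\<forall>g\<in>insert h F. blinfun_apply g z = blinfun_apply g x) \<and>
      norm z \<le> C * (\<Sum>g\<in>insert h F. norm (blinfun_apply g x))" for x
    proof -
      obtain z where z: "\<And>g. g \<in> F \<Longrightarrow> blinfun_apply g z = blinfun_apply g x"
        "norm z \<le> C * ?S x"
        using C by blast
      from z(1) have "\<forall>g\<in>F. blinfun_apply g (z - x) = 0" by (simp add: blinfun.diff_right)
      with False have "blinfun_apply h (z - x) = 0" by blast
      then have "blinfun_apply h z = blinfun_apply h x" by (simp add: blinfun.diff_right)
      moreover have "norm z \<le> C * (norm (blinfun_apply h x) + ?S x)"
        using z(2) \<open>C \<ge> 0\<close> by (simp add: algebra_simps add_increasing)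
      ultimately show ?thesis using z(1) by (auto simp: sum_insert)
    qed
    with \<open>C \<ge> 0\<close> show ?thesis by blast
  qed
qed

text \<open>
  A vector \<open>y\<^sub>k\<close> of the unit ball at which \<open>f\<^sub>k\<close> is large need not be close to the common kernel of \<open>F\<close>, and
  projecting it there could destroy the norm bound. A difference \<open>y\<^sub>k - y\<^sub>l\<close> of two such vectors
  on which \<open>F\<close> nearly agrees is close to the kernel, and \<open>f\<^sub>k\<close> remains large on it because it was
  chosen small at the earlier \<open>y\<^sub>l\<close>. The bound on the norm of \<open>x\<close> does not depend on \<open>F\<close>, \<open>Y\<close> or
  \<open>\<delta>\<close>, which is what allows the choice to be iterated.
\<close>
lemma almost_annihilating_pair:
  fixes scl :: "'k::real_or_complex \<Rightarrow> 'a::banach \<Rightarrow> 'a"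
  assumes scl: "banach_space_over scl" and D: "D \<subseteq> dual scl" "bounded D" and "\<epsilon> > 0"
    and small: "\<And>Y \<delta>. finite Y \<Longrightarrow> \<delta> > 0 \<Longrightarrow>
      \<exists>f\<in>D. \<epsilon> \<le> norm f \<and> (\<forall>y\<in>Y. norm (blinfun_apply f y) < \<delta>)"
    and F: "finite F" "F \<subseteq> dual scl" and Y: "finite Y" and "\<delta> > 0"
  shows "\<exists>f\<in>D. \<exists>x. blinfun_apply f x = 1 \<and> norm x \<le> 12 / \<epsilon> \<and>
    (\<forall>y\<in>Y. norm (blinfun_apply f y) \<le> \<delta>) \<and> (\<forall>g\<in>F. blinfun_apply g x = 0)"
proof -
  obtain B where "B > 0" and B: "\<And>f. f \<in> D \<Longrightarrow> norm f \<le> B"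
    using D(2) by (auto simp: bounded_pos)
  obtain C where "C \<ge> 0" and
    C: "\<And>x. \<exists>z. (\<forall>g\<in>F. blinfun_apply g z = blinfun_apply g x) \<and>
      norm z \<le> C * (\<Sum>g\<in>F. norm (blinfun_apply g x))"
    using controlled_lift[OF scl F] by blast
  \<comment> \<open>Of the value above \<open>\<epsilon> / 2\<close> of \<open>f\<^sub>k\<close> at \<open>y\<^sub>k\<close>, at most \<open>\<epsilon> / 8\<close> is lost by subtracting \<open>y\<^sub>l\<close> and at most
    \<open>\<epsilon> / 8\<close> by the correction \<open>z\<close>, whose norm is at most \<open>\<eta>\<close>.\<close>
  define \<delta>0 where "\<delta>0 = min \<delta> (\<epsilon> / 8)"
  have \<delta>0: "\<delta>0 > 0" "\<delta>0 \<le> \<delta>" "\<delta>0 \<le> \<epsilon> / 8" using \<open>\<epsilon> > 0\<close> \<open>\<delta> > 0\<close> by (auto simp: \<delta>0_def)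
  define \<eta> where "\<eta> = min 1 (\<epsilon> / (8 * B))"
  have \<eta>: "\<eta> > 0" "\<eta> \<le> 1" "B * \<eta> \<le> \<epsilon> / 8"
  proof -
    have "B * \<eta> \<le> B * (\<epsilon> / (8 * B))" unfolding \<eta>_def using \<open>B > 0\<close> by (intro mult_left_mono) auto
    then show "B * \<eta> \<le> \<epsilon> / 8" using \<open>B > 0\<close> by simp
  qed (use \<open>\<epsilon> > 0\<close> \<open>B > 0\<close> in \<open>auto simp: \<eta>_def\<close>)
  define \<delta>1 where "\<delta>1 = \<eta> / (C * card F + 1)"
  have "C * card F + 1 > 0" using \<open>C \<ge> 0\<close> by (simp add: add_nonneg_pos)
  then have \<delta>1: "\<delta>1 > 0" "C * (card F * \<delta>1) \<le> \<eta>"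
    using \<eta>(1) \<open>C \<ge> 0\<close> by (auto simp: \<delta>1_def field_simps)
  let ?P = "\<lambda>s (k::nat) (f, y). f \<in> D \<and> norm y \<le> 1 \<and> \<epsilon> / 2 < norm (blinfun_apply f y) \<and>
    (\<forall>u\<in>Y. norm (blinfun_apply f u) < \<delta>0) \<and> (\<forall>l<k. norm (blinfun_apply f (snd (s l))) < \<delta>0)"
  have "\<exists>s. \<forall>k. ?P s k (s k)"
  proof (rule dependent_wellorder_choice)
    fix k and s :: "nat \<Rightarrow> ('a \<Rightarrow>\<^sub>L 'k) \<times> 'a"
    have "finite (Y \<union> (snd \<circ> s) ` {..<k})" using Y by simp
    from small[OF this \<delta>0(1)] obtain f where f: "f \<in> D" "\<epsilon> \<le> norm f"
      "\<forall>u\<in>Y \<union> (snd \<circ> s) ` {..<k}. norm (blinfun_apply f u) < \<delta>0" by blast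
    have "\<epsilon> / 2 < norm f" using f(2) \<open>\<epsilon> > 0\<close> by simp
    from almost_norming_vector[OF this] obtain y where "norm y \<le> 1" "\<epsilon> / 2 < norm (blinfun_apply f y)"
      by blast
    with f show "\<exists>r. ?P s k r" by (intro exI[of _ "(f, y)"]) auto
  qed (auto split: prod.splits)
  then obtain s where "\<And>k. ?P s k (s k)" by blast
  moreover define f y where "f k = fst (s k)" and "y k = snd (s k)" for k
  ultimately have f: "f k \<in> D" and y: "norm (y k) \<le> 1" and fy: "\<epsilon> / 2 < norm (blinfun_apply (f k) (y k))"
    and fY: "\<And>u. u \<in> Y \<Longrightarrow> norm (blinfun_apply (f k) u) < \<delta>0"
    and fyl: "\<And>l. l < k \<Longrightarrow> norm (blinfun_apply (f k) (y l)) < \<delta>0" for k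
    by (auto simp: case_prod_beta)
  have "bounded (range (\<lambda>k. blinfun_apply g (y k)))" for g :: "'a \<Rightarrow>\<^sub>L 'k"
  proof -
    have "norm (blinfun_apply g (y k)) \<le> norm g" for k
      using norm_blinfun[of g "y k"] mult_left_mono[OF y[of k], of "norm g"] by simp
    then show ?thesis by (auto simp: bounded_iff)
  qed
  then obtain l k where "l < k"
    and lk: "\<And>g. g \<in> F \<Longrightarrow> norm (blinfun_apply g (y k) - blinfun_apply g (y l)) < \<delta>1"
    using pigeonhole_scalars[where u = "\<lambda>k g. blinfun_apply g (y k)", OF F(1) _ \<delta>1(1)] by blast
  obtain z where z: "\<And>g. g \<in> F \<Longrightarrow> blinfun_apply g z = blinfun_apply g (y k - y l)"
    and norm_z: "norm z \<le> C * (\<Sum>g\<in>F. norm (blinfun_apply g (y k - y l)))"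
    using C[of "y k - y l"] by blast
  have "(\<Sum>g\<in>F. norm (blinfun_apply g (y k - y l))) \<le> card F * \<delta>1"
    using lk by (intro sum_bounded_above) (auto simp: blinfun.diff_right less_imp_le)
  then have "norm z \<le> \<eta>"
    using norm_z \<delta>1(2) \<open>C \<ge> 0\<close> by (meson mult_left_mono order_trans)
  have "norm (blinfun_apply (f k) z) \<le> B * \<eta>"
    using norm_blinfun[of "f k" z] mult_mono[OF B[OF f[of k]] \<open>norm z \<le> \<eta>\<close>] \<open>B > 0\<close> by simp
  then have fz: "norm (blinfun_apply (f k) z) \<le> \<epsilon> / 8" using \<eta>(3) by simp
  define u where "u = y k - y l - z"
  have "norm u \<le> 3"
    unfolding u_def using norm_triangle_ineq4[of "y k - y l" z] norm_triangle_ineq4[of "y k" "y l"]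
      y[of k] y[of l] \<open>norm z \<le> \<eta>\<close> \<eta>(2) by linarith
  have "norm (blinfun_apply (f k) (y k)) \<le> norm (blinfun_apply (f k) u)
      + norm (blinfun_apply (f k) (y l)) + norm (blinfun_apply (f k) z)"
  proof -
    have "blinfun_apply (f k) (y k)
        = blinfun_apply (f k) u + blinfun_apply (f k) (y l) + blinfun_apply (f k) z"
      by (simp add: u_def blinfun.diff_right)
    then show ?thesis
      using norm_triangle_ineq[of "blinfun_apply (f k) u + blinfun_apply (f k) (y l)" "blinfun_apply (f k) z"]
        norm_triangle_ineq[of "blinfun_apply (f k) u" "blinfun_apply (f k) (y l)"] by simp
  qed
  then have fu: "\<epsilon> / 4 \<le> norm (blinfun_apply (f k) u)"
    using fy[of k] fz fyl[OF \<open>l < k\<close>] \<delta>0(3) by linarith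
  define c where "c = blinfun_apply (f k) u"
  have "c \<noteq> 0" using fu \<open>\<epsilon> > 0\<close> by (auto simp: c_def)
  have lin: "blinfun_apply g (scl a x) = a * blinfun_apply g x" if "g \<in> dual scl" for g a x
    using that by (simp add: dual_def)
  have "blinfun_apply (f k) (scl (inverse c) u) = 1"
    using \<open>c \<noteq> 0\<close> f[of k] D(1) by (simp add: lin subsetD flip: c_def)
  moreover have "norm (scl (inverse c) u) \<le> 12 / \<epsilon>"
  proof -
    have "norm (scl (inverse c) u) = norm u / norm c"
      by (simp add: banach_space_over.norm_scl[OF scl] norm_inverse divide_inverse mult.commute)
    also have "\<dots> \<le> 3 / (\<epsilon> / 4)"
      using \<open>norm u \<le> 3\<close> fu \<open>\<epsilon> > 0\<close> by (intro frac_le) (auto simp: c_def)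
    finally show ?thesis by simp
  qed
  moreover have "norm (blinfun_apply (f k) v) \<le> \<delta>" if "v \<in> Y" for v
    using fY[OF that, of k] \<delta>0(2) by simp
  moreover have "blinfun_apply g (scl (inverse c) u) = 0" if "g \<in> F" for g
  proof -
    have "blinfun_apply g u = 0" using z[OF that] by (simp add: u_def blinfun.diff_right)
    then show ?thesis using that F(2) by (simp add: lin subsetD)
  qed
  ultimately show ?thesis using f[of k] by blast
qed

section \<open>Finite norming sets\<close>

lemma norm_dual_scale: "norm (dual_scale c f) = norm c * norm f"
proof (rule antisym)
  show "norm (dual_scale c f) \<le> norm c * norm f"
    using norm_blinfun[of f] by (intro norm_blinfun_bound) (auto simp: norm_mult mult.assoc mult_left_mono)
  show "norm c * norm f \<le> norm (dual_scale c f)"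
  proof (cases "c = 0")
    case False
    have "norm f \<le> norm (dual_scale c f) / norm c"
    proof (rule norm_blinfun_bound)
      fix x
      show "norm (blinfun_apply f x) \<le> norm (dual_scale c f) / norm c * norm x"
        using norm_blinfun[of "dual_scale c f" x] False by (simp add: norm_mult field_simps)
    qed simp
    with False show ?thesis by (simp add: field_simps)
  qed simp
qed

lemma combination_apply:
  "blinfun_apply (\<Sum>k\<in>I. dual_scale (a k) (f k)) x = (\<Sum>k\<in>I. a k * blinfun_apply (f k) x)"
  by (simp add: blinfun.sum_left)

lemma combination_coefficient:
  assumes "finite I" "j \<in> I" and "\<And>i. i \<in> I \<Longrightarrow> blinfun_apply (f i) (v j) = (if i = j then 1 else 0)"
  shows "blinfun_apply (\<Sum>k\<in>I. dual_scale (a k) (f k)) (v j) = a j"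
proof -
  have "(\<Sum>k\<in>I. a k * blinfun_apply (f k) (v j)) = (\<Sum>k\<in>I. if k = j then a k else 0)"
    using assms(3) by (intro sum.cong) auto
  then show ?thesis using assms(1,2) by (simp add: combination_apply)
qed

text \<open>
  A finite net of the unit sphere of the span, together with vectors nearly norming the members
  of the net, does it. Biorthogonality bounds the coefficients of a combination by its norm, so the
  pigeonhole principle for coefficients excludes a separated sequence in the sphere.
\<close>
lemma finite_norming_set:
  fixes f :: "nat \<Rightarrow> 'a::banach \<Rightarrow>\<^sub>L 'k::real_or_complex"
  assumes bi: "\<And>i j. i < n \<Longrightarrow> j < n \<Longrightarrow> blinfun_apply (f i) (v j) = (if i = j then 1 else 0)"
  shows "\<exists>Y. finite Y \<and> Y \<subseteq> cball 0 1 \<and> (\<forall>a. \<exists>y\<in>Y.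
    norm (\<Sum>k<n. dual_scale (a k) (f k)) \<le> 2 * norm (blinfun_apply (\<Sum>k<n. dual_scale (a k) (f k)) y))"
proof -
  interpret vector_space "dual_scale :: 'k \<Rightarrow> ('a \<Rightarrow>\<^sub>L 'k) \<Rightarrow> ('a \<Rightarrow>\<^sub>L 'k)" by (rule vector_space_dual_scale)
  let ?G = "\<lambda>a. \<Sum>k<n. dual_scale (a k) (f k)"
  define S where "S = {?G a | a. norm (?G a) = 1}"
  have "\<exists>T. finite T \<and> T \<subseteq> S \<and> (\<forall>g\<in>S. \<exists>t\<in>T. dist g t < 1 / 4)"
  proof (rule ccontr)
    assume nonet: "\<not> ?thesis"
    have "\<exists>s::nat \<Rightarrow> _. range s \<subseteq> S \<and> (\<forall>l m. l < m \<longrightarrow> 1 / 4 \<le> dist (s m) (s l))"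
      by (rule mp[OF iffD1[OF disj_imp finite_net_or_separated_sequence] nonet])
    then obtain s :: "nat \<Rightarrow> _" where s: "range s \<subseteq> S"
      and sep: "\<And>l m. l < m \<Longrightarrow> 1 / 4 \<le> dist (s m) (s l)"
      by blast
    have "\<exists>a. s m = ?G a \<and> norm (?G a) = 1" for m
      using range_subsetD[OF s, of m] unfolding S_def mem_Collect_eq by metis
    then have "\<exists>a. \<forall>m. s m = ?G (a m) \<and> norm (?G (a m)) = 1" by (intro choice allI)
    then obtain a where a: "\<And>m. s m = ?G (a m)" "\<And>m. norm (?G (a m)) = 1" by blast
    define \<delta> where "\<delta> = 1 / (4 * (1 + (\<Sum>k<n. norm (f k))))"
    have pos: "1 + (\<Sum>k<n. norm (f k)) > 0" by (simp add: add_pos_nonneg sum_nonneg)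
    then have "\<delta> > 0" by (simp add: \<delta>_def)
    have "bounded (range (\<lambda>m. a m k))" if "k \<in> {..<n}" for k
    proof -
      have "norm (a m k) \<le> norm (v k)" for m
      proof -
        have "a m k = blinfun_apply (?G (a m)) (v k)"
          using that bi by (intro combination_coefficient[symmetric]) auto
        also have "norm \<dots> \<le> norm (v k)"
          using norm_blinfun[of "?G (a m)" "v k"] a(2) by simp
        finally show ?thesis .
      qed
      then show ?thesis by (auto simp: bounded_iff)
    qed
    from pigeonhole_scalars[where u = a, OF finite_lessThan[of n] this \<open>\<delta> > 0\<close>]
    obtain l m where "l < m" and lm: "\<And>k. k < n \<Longrightarrow> norm (a m k - a l k) < \<delta>" by auto
    have "s m - s l = (\<Sum>k<n. dual_scale (a m k - a l k) (f k))"
      by (simp add: a(1) scale_left_diff_distrib sum_subtractf)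
    also have "norm \<dots> \<le> (\<Sum>k<n. \<delta> * norm (f k))"
      using lm by (intro sum_norm_le) (simp add: norm_dual_scale mult_right_mono less_imp_le)
    also have "\<dots> < 1 / 4"
      using pos by (simp add: \<delta>_def field_simps flip: sum_distrib_left sum_divide_distrib)
    finally show False using sep[OF \<open>l < m\<close>] by (simp add: dist_norm)
  qed
  then obtain T where T: "finite T" "T \<subseteq> S" "\<And>g. g \<in> S \<Longrightarrow> \<exists>t\<in>T. dist g t < 1 / 4" by blast
  have "norm t = 1" if "t \<in> T" for t
    using subsetD[OF T(2) that] unfolding S_def by blast
  then have "\<exists>y. norm y \<le> 1 \<and> 3 / 4 < norm (blinfun_apply t y)" if "t \<in> T" for t
    using that by (intro almost_norming_vector) simp
  then have "\<exists>y. \<forall>t\<in>T. norm (y t) \<le> 1 \<and> 3 / 4 < norm (blinfun_apply t (y t))"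
    by (intro bchoice ballI)
  then obtain y where y: "\<And>t. t \<in> T \<Longrightarrow> norm (y t) \<le> 1" "\<And>t. t \<in> T \<Longrightarrow> 3 / 4 < norm (blinfun_apply t (y t))"
    by blast
  have "\<exists>u\<in>insert 0 (y ` T). norm (?G a) \<le> 2 * norm (blinfun_apply (?G a) u)" for a
  proof (cases "?G a = 0")
    case True
    then show ?thesis by (intro bexI[of _ 0]) simp_all
  next
    case False
    define r where "r = norm (?G a)"
    have "r > 0" using False by (simp add: r_def)
    let ?g = "?G (\<lambda>k. a k / of_real r)"
    have g: "blinfun_apply ?g x = blinfun_apply (?G a) x / of_real r" for x
      by (simp add: combination_apply sum_divide_distrib)
    have "?g = ?G a /\<^sub>R r"
      by (rule blinfun_eqI, unfold g blinfun.scaleR_left)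
        (simp add: scaleR_conv_of_real divide_inverse mult.commute)
    then have "norm ?g = 1" using \<open>r > 0\<close> by (simp add: r_def)
    then have "?g \<in> S"
      unfolding S_def by (intro CollectI exI[of _ "\<lambda>k. a k / of_real r"] conjI refl)
    then obtain t where t: "t \<in> T" "norm (?g - t) < 1 / 4" using T(3) by (auto simp: dist_norm)
    have "norm (blinfun_apply (?g - t) (y t)) \<le> norm (?g - t) * 1"
      using norm_blinfun[of "?g - t" "y t"] mult_left_mono[OF y(1)[OF t(1)], of "norm (?g - t)"] by simp
    then have "norm (blinfun_apply ?g (y t) - blinfun_apply t (y t)) < 1 / 4"
      using t(2) by (simp add: blinfun.diff_left)
    then have "1 / 2 < norm (blinfun_apply ?g (y t))"
      using y(2)[OF t(1)] norm_triangle_ineq2[of "blinfun_apply t (y t)" "blinfun_apply ?g (y t)"]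
      by (simp add: norm_minus_commute)
    then have "r < 2 * norm (blinfun_apply (?G a) (y t))"
      using \<open>r > 0\<close> unfolding g by (simp add: norm_divide field_simps)
    then show ?thesis using t(1) by (intro bexI[of _ "y t"]) (auto simp: r_def)
  qed
  moreover have "finite (insert 0 (y ` T))" "insert 0 (y ` T) \<subseteq> cball 0 1"
    using T(1) y(1) by auto
  ultimately show ?thesis by blast
qed

section \<open>Construction of the biorthogonal sequence\<close>

lemma limit_of_geometric_steps:
  fixes u :: "nat \<Rightarrow> 'a::banach"
  assumes step: "\<And>i. norm (u (Suc i) - u i) \<le> C * (1 / 2) ^ Suc i"
  shows "\<exists>w. u \<longlonglongrightarrow> w \<and> norm w \<le> norm (u 0) + C"
proof -
  have half: "(\<lambda>i. C * (1 / 2) ^ Suc i) sums (C * 1)"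
    by (intro sums_mult power_half_series)
  then have summ: "summable (\<lambda>i. u (Suc i) - u i)"
    using step by (intro summable_comparison_test'[OF sums_summable[OF half]])
  define w where "w = u 0 + (\<Sum>i. u (Suc i) - u i)"
  have "(\<lambda>n. u 0 + (\<Sum>i<n. u (Suc i) - u i)) \<longlonglongrightarrow> w"
    unfolding w_def by (intro tendsto_intros summable_LIMSEQ summ)
  then have "u \<longlonglongrightarrow> w" by (simp add: sum_lessThan_telescope)
  moreover have "norm (\<Sum>i. u (Suc i) - u i) \<le> C"
    using norm_suminf_le[OF step sums_summable[OF half]] sums_unique[OF half] by simp
  then have "norm w \<le> norm (u 0) + C"
    unfolding w_def using norm_triangle_ineq[of "u 0"] by (meson add_left_mono order_trans)
  ultimately show ?thesis by blast
qed

text \<open>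
  A state of the construction at stage \<open>n\<close> consists of functionals, vectors biorthogonal to them
  (only the indices below \<open>n\<close> matter), and a finite set \<open>Y\<close> norming the span of the functionals.
  The functionals stay fixed, the vectors move by at most \<open>C / 2 ^ (n + 1)\<close>, and \<open>Y\<close> grows.

  For the bound on truncations, let \<open>g\<close> be the part of \<open>h = \<Sum>a\<^sub>k f\<^sub>k\<close> with indices below \<open>n\<close>.
  It is normed, up to the factor \<open>2\<close>, by a vector of the unit ball on which the remaining \<open>f\<^sub>k\<close> are at most \<open>1 / 2 ^ (k + 1)\<close>;
  since \<open>a\<^sub>k = h(w\<^sub>k)\<close> is at most \<open>2 C\<close> times the norm of \<open>h\<close>, the values of \<open>g\<close> and \<open>h\<close> there
  differ by at most \<open>2 C\<close> times the norm of \<open>h\<close>.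
\<close>
lemma biorthogonal_sequence_with_bounded_truncations:
  fixes scl :: "'k::real_or_complex \<Rightarrow> 'a::banach \<Rightarrow> 'a"
  assumes scl: "banach_space_over scl" and D: "D \<subseteq> dual scl" and "C > 0"
    and select: "\<And>F Y \<delta>. finite F \<Longrightarrow> F \<subseteq> dual scl \<Longrightarrow> finite Y \<Longrightarrow> \<delta> > 0 \<Longrightarrow>
      \<exists>f\<in>D. \<exists>x. blinfun_apply f x = 1 \<and> norm x \<le> C \<and>
        (\<forall>y\<in>Y. norm (blinfun_apply f y) \<le> \<delta>) \<and> (\<forall>g\<in>F. blinfun_apply g x = 0)"
  shows "\<exists>f w. range f \<subseteq> D \<and> biorthogonal w f \<and> (\<forall>n. norm (w n) \<le> 2 * C) \<and>
    (\<forall>a n N. n \<le> N \<longrightarrow> norm (\<Sum>k<n. dual_scale (a k) (f k))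
      \<le> (2 + 4 * C) * norm (\<Sum>k<N. dual_scale (a k) (f k)))"
proof -
  let ?G = "\<lambda>f (n::nat) a. \<Sum>k<n. dual_scale (a k) (f k)"
  let ?norming = "\<lambda>Y f n. \<forall>a. \<exists>y\<in>Y. norm (?G f n a) \<le> 2 * norm (blinfun_apply (?G f n a) y)"
  let ?P = "\<lambda>n::nat. \<lambda>(f, v, Y). f ` {..<n} \<subseteq> D \<and>
    (\<forall>i<n. \<forall>j<n. blinfun_apply (f i) (v j) = (if i = j then 1 else 0)) \<and>
    finite Y \<and> Y \<subseteq> cball 0 1 \<and> ?norming Y f n"
  let ?Q = "\<lambda>n::nat. \<lambda>(f, v, Y) (f', v', Y'). (\<forall>m<n. f' m = f m) \<and>
    (\<forall>m<n. norm (v' m - v m) \<le> C * (1 / 2) ^ Suc n) \<and> norm (v' n) \<le> C \<and>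
    (\<forall>y\<in>Y. norm (blinfun_apply (f' n) y) \<le> (1 / 2) ^ Suc n) \<and> Y \<subseteq> Y'"
  have "\<exists>s. \<forall>n. ?P n (s n) \<and> ?Q n (s n) (s (Suc n))"
  proof (rule dependent_nat_choice)
    have "?P 0 (\<lambda>_. 0, \<lambda>_. 0, {0})" by simp
    then show "\<exists>s. ?P 0 s" ..
  next
    fix s :: "(nat \<Rightarrow> 'a \<Rightarrow>\<^sub>L 'k) \<times> (nat \<Rightarrow> 'a) \<times> 'a set" and n
    assume P: "?P n s"
    obtain f v Y where s: "s = (f, v, Y)" by (cases s)
    from P have fD: "f ` {..<n} \<subseteq> D"
      and bi: "\<And>i j. i < n \<Longrightarrow> j < n \<Longrightarrow> blinfun_apply (f i) (v j) = (if i = j then 1 else 0)"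
      and Y: "finite Y" "Y \<subseteq> cball 0 1"
      by (auto simp: s)
    have "finite (f ` {..<n})" "f ` {..<n} \<subseteq> dual scl" "finite (Y \<union> v ` {..<n})"
      "(1 / 2 :: real) ^ Suc n > 0"
      using fD D Y(1) by auto
    from select[OF this] obtain h x where h: "h \<in> D" "blinfun_apply h x = 1" and x: "norm x \<le> C"
      and hY: "\<And>y. y \<in> Y \<Longrightarrow> norm (blinfun_apply h y) \<le> (1 / 2) ^ Suc n"
      and hv: "\<And>m. m < n \<Longrightarrow> norm (blinfun_apply h (v m)) \<le> (1 / 2) ^ Suc n"
      and fx: "\<And>m. m < n \<Longrightarrow> blinfun_apply (f m) x = 0"
      by auto
    define f' where "f' = f(n := h)"
    \<comment> \<open>Since \<open>h x = 1\<close> and the old functionals vanish at \<open>x\<close>, this restores biorthogonality exactly.\<close>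
    define v' where "v' = (\<lambda>m. if m < n then v m - scl (blinfun_apply h (v m)) x else x)"
    have lin: "blinfun_apply g (scl c y) = c * blinfun_apply g y" if "g \<in> D" for g c y
      using that D by (auto simp: dual_def)
    have bi': "blinfun_apply (f' i) (v' j) = (if i = j then 1 else 0)" if "i < Suc n" "j < Suc n" for i j
    proof (cases "i < n")
      case True
      then have "f i \<in> D" using fD by auto
      with True show ?thesis using that
        by (auto simp: f'_def v'_def bi fx blinfun.diff_right lin)
    next
      case False
      with that have "i = n" by simp
      with that show ?thesis
        by (auto simp: f'_def v'_def h(2) blinfun.diff_right lin[OF h(1)])
    qed
    from finite_norming_set[of "Suc n" f' v', OF this] obtain Z where
      Z: "finite Z" "Z \<subseteq> cball 0 1" "?norming Z f' (Suc n)" by blast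
    have "?norming (Y \<union> Z) f' (Suc n)" using Z(3) by blast
    moreover have "f' ` {..<Suc n} \<subseteq> D" using fD h(1) by (auto simp: f'_def less_Suc_eq)
    ultimately have "?P (Suc n) (f', v', Y \<union> Z)"
      using bi' Y Z(1,2) by auto
    moreover have "norm (v' m - v m) \<le> C * (1 / 2) ^ Suc n" if "m < n" for m
    proof -
      have "norm (v' m - v m) = norm (blinfun_apply h (v m)) * norm x"
        using that by (simp add: v'_def banach_space_over.norm_scl[OF scl])
      also have "\<dots> \<le> (1 / 2) ^ Suc n * C"
        using hv[OF that] x by (intro mult_mono) auto
      finally show ?thesis by (simp add: mult.commute)
    qed
    then have "?Q n s (f', v', Y \<union> Z)"
      using x hY by (auto simp: s f'_def v'_def)
    ultimately have "?P (Suc n) (f', v', Y \<union> Z) \<and> ?Q n s (f', v', Y \<union> Z)" by (rule conjI)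
    then show "\<exists>t. ?P (Suc n) t \<and> ?Q n s t" by (rule exI)
  qed
  then obtain s where s: "\<forall>n. ?P n (s n) \<and> ?Q n (s n) (s (Suc n))" by (rule exE)
  define F V Y where "F n = fst (s n)" and "V n = fst (snd (s n))" and "Y n = snd (snd (s n))" for n
  have FD: "F n ` {..<n} \<subseteq> D" and Y1: "Y n \<subseteq> cball 0 1" and norming: "?norming (Y n) (F n) n" for n
    using conjunct1[OF spec[OF s, of n]] by (auto simp: F_def V_def Y_def case_prod_beta)
  have bi: "i < n \<Longrightarrow> j < n \<Longrightarrow> blinfun_apply (F n i) (V n j) = (if i = j then 1 else 0)" for n i j
    using conjunct1[OF spec[OF s, of n]] by (auto simp: F_def V_def Y_def case_prod_beta)
  have F_step: "m < n \<Longrightarrow> F (Suc n) m = F n m"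
    and V_step: "m < n \<Longrightarrow> norm (V (Suc n) m - V n m) \<le> C * (1 / 2) ^ Suc n"
    and V_new: "norm (V (Suc n) n) \<le> C"
    and F_Y: "y \<in> Y n \<Longrightarrow> norm (blinfun_apply (F (Suc n) n) y) \<le> (1 / 2) ^ Suc n"
    and Y_step: "Y n \<subseteq> Y (Suc n)" for n m y
    using conjunct2[OF spec[OF s, of n]] by (auto simp: F_def V_def Y_def case_prod_beta)
  define f where "f k = F (Suc k) k" for k
  have F_eq: "F n m = f m" if "m < n" for n m
    using that
  proof (induction n)
    case (Suc n)
    then show ?case by (cases "m = n") (auto simp: f_def F_step)
  qed simp
  have f: "f k \<in> D" for k using FD[of "Suc k"] by (auto simp: f_def)
  have fY: "norm (blinfun_apply (f k) y) \<le> (1 / 2) ^ Suc k" if "y \<in> Y n" "n \<le> k" for y n k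
    using F_Y[of y k] lift_Suc_mono_le[of Y, OF Y_step \<open>n \<le> k\<close>] that(1) by (auto simp: f_def)
  have "\<exists>w. (\<lambda>i. V (Suc m + i) m) \<longlonglongrightarrow> w \<and> norm w \<le> norm (V (Suc m + 0) m) + C" for m
  proof (rule limit_of_geometric_steps)
    fix i
    have "norm (V (Suc (Suc m + i)) m - V (Suc m + i) m) \<le> C * (1 / 2) ^ Suc (Suc m + i)"
      by (intro V_step) simp
    also have "\<dots> \<le> C * (1 / 2) ^ Suc i"
      using \<open>C > 0\<close> by (intro mult_left_mono power_decreasing) auto
    finally show "norm (V (Suc m + Suc i) m - V (Suc m + i) m) \<le> C * (1 / 2) ^ Suc i" by simp
  qed
  then obtain w where lim: "\<And>m. (\<lambda>i. V (Suc m + i) m) \<longlonglongrightarrow> w m"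
    and "\<And>m. norm (w m) \<le> norm (V (Suc m + 0) m) + C" by metis
  then have w: "norm (w m) \<le> 2 * C" for m
    using V_new[of m] by (smt (verit) add_0_right)
  have biorth: "blinfun_apply (f i) (w j) = (if i = j then 1 else 0)" for i j
  proof (rule LIMSEQ_unique)
    show "(\<lambda>n. blinfun_apply (f i) (V (Suc j + n) j)) \<longlonglongrightarrow> blinfun_apply (f i) (w j)"
      by (intro blinfun.tendsto tendsto_const lim)
    have "blinfun_apply (f i) (V (Suc j + n) j) = (if i = j then 1 else 0)" if "n \<ge> i" for n
      using bi[of i "Suc j + n" j] F_eq[of i "Suc j + n"] that by simp
    then have "\<forall>\<^sub>F n in sequentially. blinfun_apply (f i) (V (Suc j + n) j) = (if i = j then 1 else 0)"
      unfolding eventually_sequentially by blast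
    then show "(\<lambda>n. blinfun_apply (f i) (V (Suc j + n) j)) \<longlonglongrightarrow> (if i = j then 1 else 0)"
      by (rule tendsto_eventually)
  qed
  have trunc: "norm (?G f n a) \<le> (2 + 4 * C) * norm (?G f N a)" if "n \<le> N" for a n N
  proof -
    let ?g = "?G f n a" and ?h = "?G f N a"
    have "?G (F n) n a = ?g" by (intro sum.cong) (auto simp: F_eq)
    with norming[of n] obtain y where y: "y \<in> Y n" "norm ?g \<le> 2 * norm (blinfun_apply ?g y)"
      by metis
    have a: "norm (a k) \<le> 2 * C * norm ?h" if "k < N" for k
    proof -
      have "a k = blinfun_apply ?h (w k)"
        using that by (intro combination_coefficient[symmetric]) (auto simp: biorth)
      also have "norm \<dots> \<le> norm ?h * norm (w k)" by (rule norm_blinfun)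
      also have "\<dots> \<le> norm ?h * (2 * C)" by (intro mult_left_mono w) simp
      finally show ?thesis by (simp add: mult.commute)
    qed
    have half: "(\<Sum>k\<in>{n..<N}. (1 / 2 :: real) ^ Suc k) \<le> 1"
    proof -
      have "(\<Sum>k\<in>{n..<N}. (1 / 2 :: real) ^ Suc k) \<le> (\<Sum>k. (1 / 2) ^ Suc k)"
        using sums_summable[OF power_half_series] by (intro sum_le_suminf) auto
      then show ?thesis using sums_unique[OF power_half_series] by simp
    qed
    have split: "?h = ?g + (\<Sum>k\<in>{n..<N}. dual_scale (a k) (f k))"
      using sum.union_disjoint[of "{..<n}" "{n..<N}" "\<lambda>k. dual_scale (a k) (f k)"] that
      by (simp add: ivl_disj_un ivl_disj_int)
    have "norm (\<Sum>k\<in>{n..<N}. a k * blinfun_apply (f k) y)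
        \<le> (\<Sum>k\<in>{n..<N}. 2 * C * norm ?h * (1 / 2) ^ Suc k)"
    proof (rule sum_norm_le)
      fix k
      assume k: "k \<in> {n..<N}"
      show "norm (a k * blinfun_apply (f k) y) \<le> 2 * C * norm ?h * (1 / 2) ^ Suc k"
        unfolding norm_mult using k \<open>C > 0\<close> by (intro mult_mono a fY[OF y(1)]) auto
    qed
    also have "\<dots> \<le> 2 * C * norm ?h"
      unfolding sum_distrib_left[symmetric] using half \<open>C > 0\<close> by (intro mult_left_le) auto
    finally have tail: "norm (blinfun_apply ?h y - blinfun_apply ?g y) \<le> 2 * C * norm ?h"
      by (simp add: split blinfun.add_left combination_apply)
    have "norm (blinfun_apply ?h y) \<le> norm ?h"
      using norm_blinfun[of ?h y] mult_left_mono[of "norm y" 1 "norm ?h"] Y1[of n] y(1) by auto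
    moreover have "norm (blinfun_apply ?g y)
        \<le> norm (blinfun_apply ?h y) + norm (blinfun_apply ?h y - blinfun_apply ?g y)"
      using norm_triangle_sub[of "blinfun_apply ?g y" "blinfun_apply ?h y"]
      by (simp add: norm_minus_commute)
    ultimately have "norm (blinfun_apply ?g y) \<le> norm ?h + 2 * C * norm ?h"
      using tail by linarith
    with y(2) show ?thesis by (simp add: algebra_simps)
  qed
  show ?thesis
    using f biorth w trunc by (intro exI[of _ f] exI[of _ w]) (auto simp: biorthogonal_def)
qed

section \<open>Basic sequences\<close>

lemma span_range_eq_combinations:
  fixes e :: "nat \<Rightarrow> 'a::banach \<Rightarrow>\<^sub>L 'k::real_or_complex"
  assumes "g \<in> module.span dual_scale (range e)"
  shows "\<exists>a N. g = (\<Sum>k<N. dual_scale (a k) (e k))"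
proof -
  interpret vector_space "dual_scale :: 'k \<Rightarrow> ('a \<Rightarrow>\<^sub>L 'k) \<Rightarrow> ('a \<Rightarrow>\<^sub>L 'k)" by (rule vector_space_dual_scale)
  from assms show ?thesis
  proof (induction rule: span_induct_alt)
    case base
    show ?case by (intro exI[of _ "\<lambda>_. 0"] exI[of _ 0]) simp
  next
    case (step c x y)
    then obtain j a N where x: "x = e j" and y: "y = (\<Sum>k<N. dual_scale (a k) (e k))" by blast
    define M where "M = max N (Suc j)"
    define b where "b k = (if k = j then c else 0) + (if k < N then a k else 0)" for k
    have "(\<Sum>k<M. dual_scale (if k < N then a k else 0) (e k)) = y"
      unfolding y by (rule sum.mono_neutral_cong_right) (auto simp: M_def)
    moreover have "(\<Sum>k<M. dual_scale (if k = j then c else 0) (e k)) = dual_scale c x"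
    proof -
      have "(\<Sum>k<M. dual_scale (if k = j then c else 0) (e k)) = (\<Sum>k\<in>{j}. dual_scale c (e k))"
        by (rule sum.mono_neutral_cong_right) (auto simp: M_def)
      then show ?thesis by (simp add: x)
    qed
    ultimately have "dual_scale c x + y = (\<Sum>k<M. dual_scale (b k) (e k))"
      by (simp add: b_def scale_left_distrib sum.distrib)
    then show ?case by blast
  qed
qed

text \<open>
  The operators \<open>S n v = (\<Sum>k<n. v(w\<^sub>k) f\<^sub>k)\<close> are uniformly bounded on the span by the
  hypothesis, hence on its closure by continuity, and they fix every member of the span from some \<open>n\<close> on.
  Therefore they converge pointwise to the identity on the closure. The coefficients are
  unique because \<open>w\<^sub>k\<close> reads off the one with index \<open>k\<close>.
\<close>
lemma basic_sequence_if_bounded_truncations: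
  fixes f :: "nat \<Rightarrow> 'a::banach \<Rightarrow>\<^sub>L 'k::real_or_complex"
  assumes bi: "biorthogonal w f"
    and trunc: "\<And>a n N. n \<le> N \<Longrightarrow> norm (\<Sum>k<n. dual_scale (a k) (f k))
      \<le> M * norm (\<Sum>k<N. dual_scale (a k) (f k))"
  shows "basic_sequence dual_scale f"
proof -
  interpret vector_space "dual_scale :: 'k \<Rightarrow> ('a \<Rightarrow>\<^sub>L 'k) \<Rightarrow> ('a \<Rightarrow>\<^sub>L 'k)" by (rule vector_space_dual_scale)
  have biorth: "blinfun_apply (f i) (w j) = (if i = j then 1 else 0)" for i j
    using bi by (simp add: biorthogonal_def)
  define S where "S n v = (\<Sum>k<n. dual_scale (blinfun_apply v (w k)) (f k))" for n v
  have S_diff: "S n (u - v) = S n u - S n v" for n u v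
    by (simp add: S_def blinfun.diff_left scale_left_diff_distrib sum_subtractf)
  have S_comb: "S n (\<Sum>k<N. dual_scale (a k) (f k)) = (\<Sum>k<min n N. dual_scale (a k) (f k))" for n a N
  proof -
    have coeff: "blinfun_apply (\<Sum>k<N. dual_scale (a k) (f k)) (w j) = (if j < N then a j else 0)" for j
    proof (cases "j < N")
      case True
      then show ?thesis using combination_coefficient[of "{..<N}" j f w a] by (simp add: biorth)
    next
      case False
      then show ?thesis by (auto simp: combination_apply biorth intro!: sum.neutral)
    qed
    show ?thesis unfolding S_def coeff
      by (rule sum.mono_neutral_cong_right) auto
  qed
  have S_span: "norm (S n g) \<le> \<bar>M\<bar> * norm g" if g: "g \<in> span (range f)" for n g
  proof -
    obtain a N where g: "g = (\<Sum>k<N. dual_scale (a k) (f k))"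
      using span_range_eq_combinations[OF g] by blast
    have "norm (S n g) \<le> M * norm g"
      unfolding g S_comb by (rule trunc) simp
    also have "\<dots> \<le> \<bar>M\<bar> * norm g" by (intro mult_right_mono) auto
    finally show ?thesis .
  qed
  have cont: "continuous_on UNIV (S n)" for n
  proof -
    have "bounded_linear (\<lambda>v. dual_scale (blinfun_apply v x) g)" for x :: 'a and g :: "'a \<Rightarrow>\<^sub>L 'k"
    proof (rule bounded_linear_intro)
      show "norm (dual_scale (blinfun_apply v x) g) \<le> norm v * (norm x * norm g)" for v
        using norm_blinfun[of v x]
        by (simp add: norm_dual_scale mult_right_mono flip: mult.assoc)
    qed (auto intro!: blinfun_eqI simp: blinfun.add_left blinfun.scaleR_left algebra_simps)
    then show ?thesis
      unfolding S_def by (intro continuous_on_sum linear_continuous_on)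
  qed
  have conv: "(\<lambda>n. S n v) \<longlonglongrightarrow> v" if v: "v \<in> closure (span (range f))" for v
  proof (rule LIMSEQ_I)
    fix r :: real
    assume "r > 0"
    have "r / (\<bar>M\<bar> + 1) > 0" using \<open>r > 0\<close> by simp
    with v obtain g where g: "g \<in> span (range f)" "dist g v < r / (\<bar>M\<bar> + 1)"
      unfolding closure_approachable by blast
    have "span (range f) \<subseteq> {u. norm (S n (u - g)) \<le> \<bar>M\<bar> * norm (u - g)}" for n
      using S_span span_diff[OF _ g(1)] by blast
    moreover have "closed {u. norm (S n (u - g)) \<le> \<bar>M\<bar> * norm (u - g)}" for n
      by (intro closed_Collect_le continuous_intros continuous_on_compose2[OF cont]) auto
    ultimately have Sv: "norm (S n (v - g)) \<le> \<bar>M\<bar> * norm (v - g)" for n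
      using closure_minimal[of "span (range f)" "{u. norm (S n (u - g)) \<le> \<bar>M\<bar> * norm (u - g)}"] v
      by blast
    obtain a N where gN: "g = (\<Sum>k<N. dual_scale (a k) (f k))"
      using span_range_eq_combinations[OF g(1)] by blast
    have "norm (S n v - v) < r" if "N \<le> n" for n
    proof -
      have "S n g = g" using that by (simp add: gN S_comb min_absorb2)
      then have "S n v - v = S n (v - g) - (v - g)" by (simp add: S_diff)
      then have "norm (S n v - v) \<le> norm (S n (v - g)) + norm (v - g)"
        using norm_triangle_ineq4 by metis
      also have "\<dots> \<le> (\<bar>M\<bar> + 1) * norm (v - g)" using Sv[of n] by (simp add: algebra_simps)
      also have "\<dots> < r"
        using g(2) by (simp add: dist_norm norm_minus_commute field_simps)
      finally show ?thesis .
    qed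
    then show "\<exists>N. \<forall>n\<ge>N. norm (S n v - v) < r" by blast
  qed
  have unique: "a = (\<lambda>k. blinfun_apply v (w k))" if sums: "(\<lambda>n. dual_scale (a n) (f n)) sums v" for a v
  proof
    fix k
    have "(\<lambda>n. blinfun_apply (dual_scale (a n) (f n)) (w k)) sums blinfun_apply v (w k)"
      using bounded_linear.sums[OF blinfun.bounded_linear_left sums] .
    moreover have "(\<lambda>n. blinfun_apply (dual_scale (a n) (f n)) (w k)) = (\<lambda>n. if n = k then a n else 0)"
      by (auto simp: biorth)
    ultimately show "a k = blinfun_apply v (w k)"
      using sums_single[of k a] sums_unique2 by metis
  qed
  have "\<exists>!a. (\<lambda>n. dual_scale (a n) (f n)) sums v" if "v \<in> closure (span (range f))" for v
  proof (rule ex1I)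
    show "(\<lambda>n. dual_scale (blinfun_apply v (w n)) (f n)) sums v"
      using conv[OF that] by (simp add: sums_def S_def)
  qed (rule unique)
  moreover have "range f \<subseteq> closure (span (range f))"
    using span_superset closure_subset by blast
  ultimately show ?thesis by (simp add: basic_sequence_def schauder_basis_def)
qed

section \<open>Weakly p-limited sets and the theorem\<close>

text \<open>
  Apply the Cauchy condition to the index sequences \<open>n\<close> and \<open>n + 1\<close>. On the differences \<open>f (r n)\<close>
  takes the value \<open>1\<close>, but it is a difference of two members of \<open>K\<close>, each eventually below \<open>1/2\<close>.
\<close>
lemma not_weakly_p_Cauchy_if_biorthogonal_to_differences:
  fixes scl :: "'k::real_or_complex \<Rightarrow> 'a::banach \<Rightarrow> 'a"
  assumes K: "weakly_p_limited scl p K" and f: "\<And>n. f n \<in> {g - h | g h. g \<in> K \<and> h \<in> K}"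
    and bi: "biorthogonal x f" and r: "strict_mono r"
  shows "\<not> weakly_p_Cauchy scl p (x \<circ> r)"
proof
  assume "weakly_p_Cauchy scl p (x \<circ> r)"
  then have "weakly_p_summable scl p (\<lambda>n. (x \<circ> r) (id n) - (x \<circ> r) (Suc n))"
    unfolding weakly_p_Cauchy_def by (auto simp: strict_mono_def)
  then have "(\<lambda>n. SUP g\<in>K. ennreal (norm (blinfun_apply g (x (r n) - x (r (Suc n)))))) \<longlonglongrightarrow> 0"
    using K by (auto simp: weakly_p_limited_def)
  then have "\<forall>\<^sub>F n in sequentially.
      (SUP g\<in>K. ennreal (norm (blinfun_apply g (x (r n) - x (r (Suc n)))))) < ennreal (1 / 2)"
    by (rule order_tendstoD(2)) (subst ennreal_less_zero_iff, simp)
  then obtain n where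
    "(SUP g\<in>K. ennreal (norm (blinfun_apply g (x (r n) - x (r (Suc n)))))) < ennreal (1 / 2)"
    by (auto simp: eventually_sequentially)
  then have small: "norm (blinfun_apply g (x (r n) - x (r (Suc n)))) < 1 / 2" if "g \<in> K" for g
    using SUP_upper[OF that, of "\<lambda>g. ennreal (norm (blinfun_apply g (x (r n) - x (r (Suc n)))))"]
    by (metis (no_types, lifting) ennreal_less_iff norm_ge_zero order_le_less_trans)
  obtain g h where gh: "f (r n) = g - h" "g \<in> K" "h \<in> K" using f[of "r n"] by blast
  have "r n \<noteq> r (Suc n)" using r by (metis strict_mono_eq n_not_Suc_n)
  then have "1 = norm (blinfun_apply (f (r n)) (x (r n) - x (r (Suc n))))"
    using bi by (simp add: biorthogonal_def blinfun.diff_right)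
  also have "\<dots> \<le> norm (blinfun_apply g (x (r n) - x (r (Suc n))))
      + norm (blinfun_apply h (x (r n) - x (r (Suc n))))"
    unfolding gh(1) blinfun.diff_left by (rule norm_triangle_ineq4)
  also have "\<dots> < 1" using small[OF gh(2)] small[OF gh(3)] by linarith
  finally show False by simp
qed

text \<open>
  The identity \<open>f\<^sub>n(x\<^sub>n) = 1\<close> makes an upper bound for either sequence a lower bound for the other.
\<close>
lemma seminormalized_if_biorthogonal_bounded:
  assumes bi: "biorthogonal x f" and x: "\<And>n. norm (x n) \<le> A" and f: "\<And>n. norm (f n) \<le> B"
  shows "seminormalized x f"
proof -
  have one: "1 \<le> norm (f n) * norm (x n)" for n
    using norm_blinfun[of "f n" "x n"] bi by (simp add: biorthogonal_def)
  have pos: "0 < norm (x n)" "0 < norm (f n)" for n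
    using one[of n] by (auto intro!: Nat.gr0I simp: zero_less_norm_iff blinfun.zero_right)
  have "A > 0" "B > 0" using pos[of 0] x[of 0] f[of 0] by linarith+
  have "1 / B \<le> norm (x n)" "1 / A \<le> norm (f n)" for n
  proof -
    have "norm (f n) * norm (x n) \<le> B * norm (x n)" by (intro mult_right_mono f) simp
    with one[of n] show "1 / B \<le> norm (x n)" using \<open>B > 0\<close> by (simp add: field_simps)
    have "norm (f n) * norm (x n) \<le> norm (f n) * A" by (intro mult_left_mono x) simp
    with one[of n] show "1 / A \<le> norm (f n)" using \<open>A > 0\<close> by (simp add: field_simps)
  qed
  with \<open>A > 0\<close> \<open>B > 0\<close> x f show ?thesis
    unfolding seminormalized_def bounded_and_away_from_zero_def
    by (meson zero_less_divide_1_iff)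
qed

theorem theorem2p6:
  fixes scl :: "'k::real_or_complex \<Rightarrow> 'a::banach \<Rightarrow> 'a"
    and p :: real
    and K :: "('a \<Rightarrow>\<^sub>L 'k) set"
  assumes "banach_space_over scl"
    and "1 \<le> p"
    and "reflexive_space scl"
    and "weakly_p_limited scl p K"
    and "\<not> compact (closure K)"
  shows "\<exists>(x :: nat \<Rightarrow> 'a) (f :: nat \<Rightarrow> 'a \<Rightarrow>\<^sub>L 'k).
           (\<forall>n. f n \<in> {g - h | g h. g \<in> K \<and> h \<in> K}) \<and>
           biorthogonal x f \<and>
           seminormalized x f \<and>
           basic_sequence dual_scale f \<and>
           \<not> (\<exists>r. strict_mono r \<and> weakly_p_Cauchy scl p (x \<circ> r))"
proof -
  let ?D = "{g - h | g h. g \<in> K \<and> h \<in> K}"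
  have K: "K \<subseteq> dual scl" "bounded K" using assms(4) by (auto simp: weakly_p_limited_def)
  have D: "?D \<subseteq> dual scl"
    using K(1) by (auto simp: dual_def subset_iff blinfun.diff_left right_diff_distrib)
  obtain B where B: "\<And>g. g \<in> K \<Longrightarrow> norm g \<le> B" using K(2) by (auto simp: bounded_iff)
  have DB: "norm f \<le> 2 * B" if "f \<in> ?D" for f
  proof -
    obtain g h where "f = g - h" "g \<in> K" "h \<in> K" using \<open>f \<in> ?D\<close> by blast
    then show ?thesis using norm_triangle_ineq4[of g h] B[of g] B[of h] by simp
  qed
  then have bD: "bounded ?D" unfolding bounded_iff by blast
  obtain \<epsilon> where "\<epsilon> > 0" and small: "\<And>Y \<delta>. finite Y \<Longrightarrow> \<delta> > 0 \<Longrightarrow>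
      \<exists>f\<in>?D. \<epsilon> \<le> norm f \<and> (\<forall>y\<in>Y. norm (blinfun_apply f y) < \<delta>)"
    using small_on_finite_set_not_small_in_norm[OF K(2) assms(5)] by blast
  from \<open>\<epsilon> > 0\<close> have "12 / \<epsilon> > 0" by simp
  from biorthogonal_sequence_with_bounded_truncations[OF assms(1) D this
      almost_annihilating_pair[OF assms(1) D bD \<open>\<epsilon> > 0\<close> small]]
  obtain f x where f: "range f \<subseteq> ?D" and bi: "biorthogonal x f"
    and x: "\<And>n. norm (x n) \<le> 2 * (12 / \<epsilon>)"
    and trunc: "\<And>a n N. n \<le> N \<Longrightarrow> norm (\<Sum>k<n. dual_scale (a k) (f k))
      \<le> (2 + 4 * (12 / \<epsilon>)) * norm (\<Sum>k<N. dual_scale (a k) (f k))"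
    by blast
  have fD: "f n \<in> ?D" for n using f by blast
  have "seminormalized x f"
    using seminormalized_if_biorthogonal_bounded[OF bi x DB[OF fD]] .
  moreover have "basic_sequence dual_scale f"
    using basic_sequence_if_bounded_truncations[OF bi trunc] .
  moreover have "\<not> (\<exists>r. strict_mono r \<and> weakly_p_Cauchy scl p (x \<circ> r))"
    using not_weakly_p_Cauchy_if_biorthogonal_to_differences[OF assms(4) fD bi] by blast
  ultimately show ?thesis using fD bi by blast
qed

end
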